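(* Let $A_n$ be one of the categories $\mathrm{UTr}_n$, $\mathrm{LTr}_n$, $\mathrm{UAlt}_n$, $\mathrm{LAlt}_n$, and let $k_1,k_2\ge 0$ be integers with $0\le k_1+k_2\le n$. There is a covariant functor $T_{k_1,k_2}$ with $T_{k_1,k_2}(A_n)=A_{n-k_1-k_2}$ such that (i) for every object $(f_1,\ldots,f_n)$ of $A_n$, $T_{k_1,k_2}(f_1,\ldots,f_n)=(\tau f_{k_1+1},\ldots,\tau f_{n-k_2})$, where $\tau$ denotes truncation of polynomials to the exponent range determined by $k_1,k_2$; and (ii) for every morphism $M_{vt}$ of $A_n$, $T_{k_1,k_2}(M_{vt})=\mathrm{tr}_{k_1,k_2}(M_{vt})$.
   Context: Fix an $n$-dimensional real space $V=\mathrm{span}\{x^{e_1},x^{e_2},\ldots,x^{e_n}\}$ where $e_i=e_1+(i-1)d$, $e_1\ge0$ and $d\in\{1,2\}$ (with $d=1$ in the alternating cases). A descending basis of $V$ is a basis $(f_1,\ldots,f_n)$ with $\deg f_i=e_i$; an ascending basis is a basis with minimum degree (least exponent with nonzero coefficient) of $f_i$ equal to $e_i$. Such a basis is alternating if moreover (with $d=1$) each $f_i$ contains only monomials with exponents congruent to $e_i$ modulo $2$. For ordered bases $v,t$ of the same space, $M_{vt}$ is the $n\times n$ matrix whose $j$-th column is the coordinate vector with respect to $v$ of the $j$-th element of $t$. The categories $\mathrm{UTr}_n$, $\mathrm{LTr}_n$, $\mathrm{UAlt}_n$, $\mathrm{LAlt}_n$ have as objects a finite set of, respectively, descending bases, ascending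 bases, descending alternating bases, ascending alternating bases of $V$; for each ordered pair $(v,t)$ of objects there is exactly one morphism $M_{vt}:v\to t$; composition is matrix product, $M_{vr}\circ M_{rt}=M_{vr}M_{rt}=M_{vt}$ (first $M_{vr}:v\to r$, then $M_{rt}:r\to t$), and identities are identity matrices. For a polynomial $f=\sum_e a_e x^e$, $\tau f=\sum_{e_{k_1+1}\le e\le e_{n-k_2}}a_e x^e$. For a matrix $M$, $\mathrm{tr}_{k_1,k_2}M$ is obtained by deleting the first $k_1$ and last $k_2$ rows and columns. $A_{n-k_1-k_2}$ is the category of the same type for the space $\mathrm{span}\{x^{e_{k_1+1}},\ldots,x^{e_{n-k_2}}\}$ whose objects are the truncated bases $T_{k_1,k_2}(v)$, $v\in\mathrm{obj}\,A_n$ (if $k_1+k_2=n$, the empty basis of the zero space, with $0\times0$ matrices). *)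

theory Defs
  imports
    "HOL-Computational_Algebra.Polynomial"
    "Jordan_Normal_Form.DL_Submatrix"
begin

section \<open>Categories and covariant functors\<close>

text \<open>Composition is written in diagrammatic order: \<open>Comp C f g\<close> is ``first \<open>f\<close>, then \<open>g\<close>''
  and is only meaningful when \<open>Cod C f = Dom C g\<close>.\<close>

record ('o, 'm) cat =
  Obj :: "'o set"
  Arr :: "'m set"
  Dom :: "'m \<Rightarrow> 'o"
  Cod :: "'m \<Rightarrow> 'o"
  Ident :: "'o \<Rightarrow> 'm"
  Comp :: "'m \<Rightarrow> 'm \<Rightarrow> 'm"

locale category =
  fixes C :: "('o, 'm) cat"
  assumes Dom_in: "f \<in> Arr C \<Longrightarrow> Dom C f \<in> Obj C"
    and Cod_in: "f \<in> Arr C \<Longrightarrow> Cod C f \<in> Obj C"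
    and Ident_in: "a \<in> Obj C \<Longrightarrow> Ident C a \<in> Arr C"
    and Dom_Ident: "a \<in> Obj C \<Longrightarrow> Dom C (Ident C a) = a"
    and Cod_Ident: "a \<in> Obj C \<Longrightarrow> Cod C (Ident C a) = a"
    and Comp_in: "\<lbrakk>f \<in> Arr C; g \<in> Arr C; Cod C f = Dom C g\<rbrakk> \<Longrightarrow> Comp C f g \<in> Arr C"
    and Dom_Comp: "\<lbrakk>f \<in> Arr C; g \<in> Arr C; Cod C f = Dom C g\<rbrakk> \<Longrightarrow> Dom C (Comp C f g) = Dom C f"
    and Cod_Comp: "\<lbrakk>f \<in> Arr C; g \<in> Arr C; Cod C f = Dom C g\<rbrakk> \<Longrightarrow> Cod C (Comp C f g) = Cod C g"
    and Ident_left: "f \<in> Arr C \<Longrightarrow> Comp C (Ident C (Dom C f)) f = f"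
    and Ident_right: "f \<in> Arr C \<Longrightarrow> Comp C f (Ident C (Cod C f)) = f"
    and Comp_assoc: "\<lbrakk>f \<in> Arr C; g \<in> Arr C; h \<in> Arr C; Cod C f = Dom C g; Cod C g = Dom C h\<rbrakk>
      \<Longrightarrow> Comp C (Comp C f g) h = Comp C f (Comp C g h)"

locale covariant_functor = A: category A + B: category B
  for A :: "('o, 'm) cat" and B :: "('p, 'q) cat" +
  fixes Fobj :: "'o \<Rightarrow> 'p" and Farr :: "'m \<Rightarrow> 'q"
  assumes Fobj_in: "a \<in> Obj A \<Longrightarrow> Fobj a \<in> Obj B"
    and Farr_in: "f \<in> Arr A \<Longrightarrow> Farr f \<in> Arr B"
    and Dom_Farr: "f \<in> Arr A \<Longrightarrow> Dom B (Farr f) = Fobj (Dom A f)"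
    and Cod_Farr: "f \<in> Arr A \<Longrightarrow> Cod B (Farr f) = Fobj (Cod A f)"
    and Farr_Ident: "a \<in> Obj A \<Longrightarrow> Farr (Ident A a) = Ident B (Fobj a)"
    and Farr_Comp: "\<lbrakk>f \<in> Arr A; g \<in> Arr A; Cod A f = Dom A g\<rbrakk>
      \<Longrightarrow> Farr (Comp A f g) = Comp B (Farr f) (Farr g)"


section \<open>Ordered polynomial bases\<close>

text \<open>Real polynomials are not an instance of class \<open>real_vector\<close>, so the linear algebra notions
  are taken from the locale \<open>vector_space\<close>.\<close>

global_interpretation poly_vs: vector_space "Polynomial.smult :: real \<Rightarrow> real poly \<Rightarrow> real poly"
  by unfold_locales (simp_all add: smult_add_right smult_add_left)

text \<open>The index is 1-based: \<open>expo e1 d i\<close> is $e_i = e_1 + (i-1)d$ for $i \ge 1$.\<close>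

definition expo :: "nat \<Rightarrow> nat \<Rightarrow> nat \<Rightarrow> nat" where
  "expo e1 d i = e1 + (i - 1) * d"

definition poly_space :: "nat \<Rightarrow> nat \<Rightarrow> nat \<Rightarrow> real poly set" where
  "poly_space n e1 d = poly_vs.span {monom 1 (expo e1 d i) | i. 1 \<le> i \<and> i \<le> n}"

definition ordered_basis :: "real poly set \<Rightarrow> real poly list \<Rightarrow> bool" where
  "ordered_basis V v \<longleftrightarrow>
     distinct v \<and> poly_vs.independent (set v) \<and> poly_vs.span (set v) = V"

definition min_degree :: "real poly \<Rightarrow> nat" where
  "min_degree f = (LEAST e. coeff f e \<noteq> 0)"

text \<open>In the following predicates list positions are 0-based, so \<open>v ! i\<close> is $f_{i+1}$.\<close>

definition descending_basis :: "nat \<Rightarrow> nat \<Rightarrow> nat \<Rightarrow> real poly list \<Rightarrow> bool" where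
  "descending_basis n e1 d v \<longleftrightarrow> ordered_basis (poly_space n e1 d) v \<and> length v = n \<and>
     (\<forall>i<n. degree (v ! i) = expo e1 d (i + 1))"

definition ascending_basis :: "nat \<Rightarrow> nat \<Rightarrow> nat \<Rightarrow> real poly list \<Rightarrow> bool" where
  "ascending_basis n e1 d v \<longleftrightarrow> ordered_basis (poly_space n e1 d) v \<and> length v = n \<and>
     (\<forall>i<n. min_degree (v ! i) = expo e1 d (i + 1))"

definition alternating :: "nat \<Rightarrow> nat \<Rightarrow> nat \<Rightarrow> real poly list \<Rightarrow> bool" where
  "alternating n e1 d v \<longleftrightarrow>
     (\<forall>i<n. \<forall>e. coeff (v ! i) e \<noteq> 0 \<longrightarrow> e mod 2 = expo e1 d (i + 1) mod 2)"

datatype kind = UTr | LTr | UAlt | LAlt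

fun basis_of_kind :: "kind \<Rightarrow> nat \<Rightarrow> nat \<Rightarrow> nat \<Rightarrow> real poly list \<Rightarrow> bool" where
  "basis_of_kind UTr n e1 d v \<longleftrightarrow> descending_basis n e1 d v"
| "basis_of_kind LTr n e1 d v \<longleftrightarrow> ascending_basis n e1 d v"
| "basis_of_kind UAlt n e1 d v \<longleftrightarrow> descending_basis n e1 d v \<and> alternating n e1 d v"
| "basis_of_kind LAlt n e1 d v \<longleftrightarrow> ascending_basis n e1 d v \<and> alternating n e1 d v"


section \<open>Categories of bases\<close>

text \<open>Column \<open>j\<close> of \<open>basis_matrix v t\<close> is the coordinate vector of \<open>t ! j\<close> with respect to \<open>v\<close>.\<close>

definition basis_matrix :: "real poly list \<Rightarrow> real poly list \<Rightarrow> real mat" where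
  "basis_matrix v t =
     mat (length v) (length t) (\<lambda>(i, j). poly_vs.representation (set v) (t ! j) (v ! i))"

text \<open>The same matrix can be the morphism of several pairs of objects (all identities, for
  instance), so an arrow \<open>v \<rightarrow> t\<close> is a matrix tagged with its domain and codomain.\<close>

type_synonym basis_arrow = "real poly list \<times> real poly list \<times> real mat"

definition basis_category :: "real poly list set \<Rightarrow> (real poly list, basis_arrow) cat" where
  "basis_category S = \<lparr>
     Obj = S,
     Arr = {(v, t, basis_matrix v t) | v t. v \<in> S \<and> t \<in> S},
     Dom = (\<lambda>(v, t, M). v),
     Cod = (\<lambda>(v, t, M). t),
     Ident = (\<lambda>v. (v, v, 1\<^sub>m (length v))),
     Comp = (\<lambda>(v, r, M) (r', t, N). (v, t, M * N)) \<rparr>"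

definition categories_of_kind ::
    "kind \<Rightarrow> nat \<Rightarrow> nat \<Rightarrow> nat \<Rightarrow> (real poly list, basis_arrow) cat set" where
  "categories_of_kind K n e1 d =
     {basis_category S | S. finite S \<and> (\<forall>v\<in>S. basis_of_kind K n e1 d v)}"


section \<open>Truncation\<close>

text \<open>The map $\tau$. If $k_1 + k_2 = n$ the exponent range is irrelevant, since
  \<open>truncate_basis\<close> then applies $\tau$ to no polynomial.\<close>

definition truncate_poly :: "nat \<Rightarrow> nat \<Rightarrow> nat \<Rightarrow> nat \<Rightarrow> nat \<Rightarrow> real poly \<Rightarrow> real poly" where
  "truncate_poly n e1 d k1 k2 f =
     (\<Sum>e \<in> {expo e1 d (k1 + 1) .. expo e1 d (n - k2)}. monom (coeff f e) e)"

definition truncate_basis ::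
    "nat \<Rightarrow> nat \<Rightarrow> nat \<Rightarrow> nat \<Rightarrow> nat \<Rightarrow> real poly list \<Rightarrow> real poly list" where
  "truncate_basis n e1 d k1 k2 v =
     map (truncate_poly n e1 d k1 k2) (drop k1 (take (n - k2) v))"

definition truncate_mat :: "nat \<Rightarrow> nat \<Rightarrow> 'a mat \<Rightarrow> 'a mat" where
  "truncate_mat k1 k2 M = submatrix M {k1..<dim_row M - k2} {k1..<dim_col M - k2}"

end

theory Submission
  imports Defs
begin

text \<open>
  Number list positions from 0 and call the exponent
  \<open>e\<^sub>i\<^sub>+\<^sub>1\<close> the pivot of position \<open>i\<close>. A descending basis is a list of polynomials
  whose coefficient table is triangular with respect to the pivots, with nonzero diagonal; an
  ascending basis is the same with the order of positions reversed. The predicate \<open>echelon s\<close>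
  covers both: positions are compared through \<open>s * i\<close>, with \<open>s = 1\<close> in the descending and
  \<open>s = - 1\<close> in the ascending case. A linear combination of such a list has a nonzero coefficient at
  the pivot of its last position (in the order given by \<open>s\<close>) with nonzero scalar. This one
  observation (\<open>echelon_leading\<close>) makes an echelon list independent, hence a basis by counting
  dimensions, and makes the change of basis matrix between two echelon lists triangular.

  The map \<open>\<tau>\<close> is linear and only discards coefficients, so the window of positions
  \<open>k\<^sub>1 \<le> i < n - k\<^sub>2\<close> of an echelon list becomes, after applying \<open>\<tau>\<close>, an echelon list for the smaller
  space. This gives the statement on objects;
  parities of exponents survive because no new exponents appear.

  For morphisms let \<open>M\<close> be the matrix from \<open>v\<close> to \<open>t\<close> and apply \<open>\<tau>\<close> to
  \<open>t\<^sub>j = \<Sum>\<^sub>i M\<^sub>i\<^sub>j v\<^sub>i\<close> with \<open>j\<close> in the window. A position \<open>i\<close> outside the window contributes nothing: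
  if \<open>i\<close> comes after \<open>j\<close> then \<open>M\<^sub>i\<^sub>j = 0\<close> by triangularity, and if \<open>i\<close> comes before \<open>j\<close> then it comes
  before the whole window, so \<open>v\<^sub>i\<close> has no coefficient at a pivot of the window and \<open>\<tau> v\<^sub>i = 0\<close>.
  Hence the truncated matrix consists of the coordinates of the truncated
  basis (\<open>truncate_mat_basis_matrix\<close>). Functoriality is then immediate, because in both categories the
  product of two change of basis matrices is again the change of basis matrix.
\<close>

section \<open>Coordinates with respect to an ordered basis\<close>

lemma sum_coordinates:
  assumes "ordered_basis V v" and "x \<in> V"
  shows "(\<Sum>i<length v. Polynomial.smult (poly_vs.representation (set v) x (v ! i)) (v ! i)) = x"
proof -
  have v: "distinct v" "poly_vs.independent (set v)" "x \<in> poly_vs.span (set v)"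
    using assms by (auto simp: ordered_basis_def)
  have "(\<Sum>i<length v. Polynomial.smult (poly_vs.representation (set v) x (v ! i)) (v ! i)) =
      (\<Sum>b\<in>set v. Polynomial.smult (poly_vs.representation (set v) x b) b)"
    by (rule sum.reindex_bij_betw[OF bij_betw_nth[OF v(1) refl refl]])
  also have "\<dots> = x"
    using v by (intro poly_vs.sum_representation_eq) auto
  finally show ?thesis .
qed

lemma representation_linear_combination:
  assumes "poly_vs.independent B" and "\<And>i. i \<in> I \<Longrightarrow> f i \<in> poly_vs.span B"
  shows "poly_vs.representation B (\<Sum>i\<in>I. Polynomial.smult (c i) (f i)) b =
    (\<Sum>i\<in>I. c i * poly_vs.representation B (f i) b)"
proof -
  have "poly_vs.representation B (\<Sum>i\<in>I. Polynomial.smult (c i) (f i)) =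
      (\<lambda>b. \<Sum>i\<in>I. poly_vs.representation B (Polynomial.smult (c i) (f i)) b)"
    using assms by (intro poly_vs.representation_sum poly_vs.span_scale)
  then show ?thesis
    using assms by (simp add: poly_vs.representation_scale)
qed

lemma representation_nth:
  assumes "ordered_basis V v" and "i < length v" and "j < length v"
  shows "poly_vs.representation (set v) (v ! j) (v ! i) = (if i = j then 1 else 0)"
  using assms by (auto simp: ordered_basis_def poly_vs.representation_basis nth_eq_iff_index_eq)

lemma coordinates_unique:
  assumes "ordered_basis V v" and "i < length v"
    and "x = (\<Sum>j<length v. Polynomial.smult (c j) (v ! j))"
  shows "poly_vs.representation (set v) x (v ! i) = c i"
proof -
  have "poly_vs.representation (set v) x (v ! i) =
      (\<Sum>j<length v. c j * poly_vs.representation (set v) (v ! j) (v ! i))"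
    unfolding assms(3) using assms(1)
    by (intro representation_linear_combination) (auto simp: ordered_basis_def poly_vs.span_base)
  also have "\<dots> = (\<Sum>j<length v. if j = i then c j else 0)"
    using assms(2) by (intro sum.cong refl) (simp add: representation_nth[OF assms(1)])
  also have "\<dots> = c i"
    using assms(2) by simp
  finally show ?thesis .
qed

lemma basis_matrix_dim [simp]:
  "dim_row (basis_matrix v t) = length v" "dim_col (basis_matrix v t) = length t"
  by (simp_all add: basis_matrix_def)

lemma basis_matrix_mult:
  assumes v: "ordered_basis V v" and r: "ordered_basis V r" and t: "ordered_basis V t"
  shows "basis_matrix v r * basis_matrix r t = basis_matrix v t"
proof (rule eq_matI)
  fix i j
  assume "i < dim_row (basis_matrix v t)" and "j < dim_col (basis_matrix v t)"
  then have i: "i < length v" and j: "j < length t"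
    by simp_all
  let ?R = "\<lambda>x b. poly_vs.representation (set x) b"
  have "t ! j \<in> V"
    using t j poly_vs.span_base[of "t ! j" "set t"] by (simp add: ordered_basis_def)
  then have "t ! j = (\<Sum>k<length r. Polynomial.smult (?R r (t ! j) (r ! k)) (r ! k))"
    using sum_coordinates[OF r] by simp
  moreover have "?R v (\<Sum>k<length r. Polynomial.smult (?R r (t ! j) (r ! k)) (r ! k)) (v ! i) =
      (\<Sum>k<length r. ?R r (t ! j) (r ! k) * ?R v (r ! k) (v ! i))"
  proof (rule representation_linear_combination)
    show "poly_vs.independent (set v)"
      using v by (simp add: ordered_basis_def)
    have "set r \<subseteq> poly_vs.span (set v)"
      using v r poly_vs.span_superset[of "set r"] by (simp add: ordered_basis_def)
    then show "r ! k \<in> poly_vs.span (set v)" if "k \<in> {..<length r}" for k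
      using that by auto
  qed
  ultimately have "?R v (t ! j) (v ! i) =
      (\<Sum>k<length r. ?R v (r ! k) (v ! i) * ?R r (t ! j) (r ! k))"
    by (simp add: mult.commute)
  then show "(basis_matrix v r * basis_matrix r t) $$ (i, j) = basis_matrix v t $$ (i, j)"
    using i j by (simp add: basis_matrix_def scalar_prod_def atLeast0LessThan)
qed simp_all

lemma basis_matrix_self:
  assumes "ordered_basis V v"
  shows "basis_matrix v v = 1\<^sub>m (length v)"
  by (rule eq_matI) (simp_all add: basis_matrix_def representation_nth[OF assms])

section \<open>Spaces spanned by monomials\<close>

lemma expo_Suc: "expo e1 d (Suc i) = e1 + i * d"
  by (simp add: expo_def)

lemma mem_poly_space_iff:
  "f \<in> poly_space n e1 d \<longleftrightarrow> (\<forall>e. coeff f e \<noteq> 0 \<longrightarrow> (\<exists>i<n. e = expo e1 d (i + 1)))"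
proof
  assume "f \<in> poly_space n e1 d"
  then have f: "f \<in> poly_vs.span {monom 1 (expo e1 d i) | i. 1 \<le> i \<and> i \<le> n}"
    by (simp add: poly_space_def)
  show "\<forall>e. coeff f e \<noteq> 0 \<longrightarrow> (\<exists>i<n. e = expo e1 d (i + 1))"
    using f
  proof (induction rule: poly_vs.span_induct_alt)
    case base
    show ?case by simp
  next
    case (step c x y)
    then obtain i where i: "1 \<le> i" "i \<le> n" and x: "x = monom 1 (expo e1 d i)"
      by auto
    show ?case
    proof (intro allI impI)
      fix e
      assume "coeff (Polynomial.smult c x + y) e \<noteq> 0"
      then have "e = expo e1 d (i - 1 + 1) \<or> coeff y e \<noteq> 0"
        using i by (auto simp: x split: if_splits)
      moreover have "i - 1 < n"
        using i by simp
      ultimately show "\<exists>i<n. e = expo e1 d (i + 1)"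
        using step.IH by blast
    qed
  qed
next
  assume H: "\<forall>e. coeff f e \<noteq> 0 \<longrightarrow> (\<exists>i<n. e = expo e1 d (i + 1))"
  have "monom (coeff f e) e \<in> poly_space n e1 d" for e
  proof (cases "coeff f e = 0")
    case True
    then show ?thesis
      by (simp add: poly_space_def poly_vs.span_zero)
  next
    case False
    then obtain i where "i < n" "e = expo e1 d (i + 1)"
      using H by blast
    then have "monom 1 e \<in> poly_space n e1 d"
      unfolding poly_space_def by (intro poly_vs.span_base CollectI exI[of _ "i + 1"]) simp
    then have "Polynomial.smult (coeff f e) (monom 1 e) \<in> poly_space n e1 d"
      unfolding poly_space_def by (rule poly_vs.span_scale)
    then show ?thesis
      by (simp add: smult_monom)
  qed
  then have "(\<Sum>e\<le>degree f. monom (coeff f e) e) \<in> poly_space n e1 d"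
    unfolding poly_space_def by (intro poly_vs.span_sum)
  then show "f \<in> poly_space n e1 d"
    by (simp add: poly_as_sum_of_monoms)
qed

text \<open>The dimension count: the space is spanned by \<open>n\<close> monomials, so \<open>n\<close> independent
  elements of it already span.\<close>

lemma ordered_basis_poly_space:
  assumes v: "distinct v" "length v = n" "poly_vs.independent (set v)" "set v \<subseteq> poly_space n e1 d"
  shows "ordered_basis (poly_space n e1 d) v"
proof -
  let ?T = "(\<lambda>i. monom (1 :: real) (expo e1 d i)) ` {1..n}"
  have T: "poly_space n e1 d = poly_vs.span ?T"
    unfolding poly_space_def by (rule arg_cong[where f = poly_vs.span]) auto
  have "poly_vs.span ?T \<subseteq> poly_vs.span (set v)"
  proof (rule ccontr)
    assume "\<not> poly_vs.span ?T \<subseteq> poly_vs.span (set v)"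
    then obtain x where x: "x \<in> poly_vs.span ?T" "x \<notin> poly_vs.span (set v)"
      by blast
    then have "poly_vs.independent (insert x (set v))"
      using v(3) by (simp add: poly_vs.independent_insertI)
    moreover have "insert x (set v) \<subseteq> poly_vs.span ?T"
      using x(1) v(4) T by simp
    ultimately have "card (insert x (set v)) \<le> card ?T"
      using poly_vs.independent_span_bound[of ?T] by blast
    moreover have "card ?T \<le> n"
      using card_image_le[of "{1..n}"] by simp
    moreover have "card (insert x (set v)) = Suc n"
      using x(2) v(1,2) poly_vs.span_base[of x "set v"] by (auto simp: card_insert_if distinct_card)
    ultimately show False
      by simp
  qed
  moreover have "poly_vs.span (set v) \<subseteq> poly_vs.span ?T"
    using v(4) T by (simp add: poly_vs.span_minimal)
  ultimately show ?thesis
    using v T by (simp add: ordered_basis_def)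
qed

section \<open>Echelon bases\<close>

text \<open>The sign \<open>s\<close> orders the positions, forwards for \<open>s = 1\<close> and backwards for \<open>s = - 1\<close>, so that
  descending and ascending bases are treated by one argument.\<close>

definition echelon :: "int \<Rightarrow> nat \<Rightarrow> nat \<Rightarrow> nat \<Rightarrow> real poly list \<Rightarrow> bool" where
  "echelon s n e1 d v \<longleftrightarrow> length v = n \<and> set v \<subseteq> poly_space n e1 d \<and>
     (\<forall>i<n. coeff (v ! i) (expo e1 d (i + 1)) \<noteq> 0) \<and>
     (\<forall>i<n. \<forall>j<n. s * int i < s * int j \<longrightarrow> coeff (v ! i) (expo e1 d (j + 1)) = 0)"

text \<open>At the pivot of the last position with a nonzero scalar, every other summand vanishes:
  the scalar is zero for later positions, and the coefficient is zero for earlier ones.\<close>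

lemma echelon_leading:
  assumes v: "echelon s n e1 d v" and s: "s \<noteq> 0"
    and i: "i < n" "c i \<noteq> 0"
  obtains m where "m < n" "s * int i \<le> s * int m"
    "coeff (\<Sum>j<n. Polynomial.smult (c j) (v ! j)) (expo e1 d (m + 1)) \<noteq> 0"
proof -
  let ?S = "{j. j < n \<and> c j \<noteq> 0}"
  let ?K = "(\<lambda>j. s * int j) ` ?S"
  have fin: "finite ?K" and ne: "?K \<noteq> {}"
    using i by auto
  obtain m where m: "m < n" "c m \<noteq> 0" and max: "Max ?K = s * int m"
    using Max_in[OF fin ne] by auto
  have le: "s * int j \<le> s * int m" if "j < n" "c j \<noteq> 0" for j
    using Max_ge[OF fin, of "s * int j"] that max by auto
  have "c j * coeff (v ! j) (expo e1 d (m + 1)) = 0" if "j < n" "j \<noteq> m" for j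
  proof (cases "c j = 0")
    case False
    then have "s * int j < s * int m"
      using le[OF that(1)] that(2) s by (simp add: less_le)
    then show ?thesis
      using v that m by (simp add: echelon_def)
  qed simp
  then have "(\<Sum>j<n. c j * coeff (v ! j) (expo e1 d (m + 1))) =
      (\<Sum>j<n. if j = m then c j * coeff (v ! j) (expo e1 d (m + 1)) else 0)"
    by (intro sum.cong) auto
  also have "\<dots> = c m * coeff (v ! m) (expo e1 d (m + 1))"
    using m by simp
  also have "\<dots> \<noteq> 0"
    using v m by (simp add: echelon_def)
  finally show thesis
    using that[OF m(1) le[OF i]] by (simp add: coeff_sum)
qed

lemma echelon_scalars_zero:
  assumes "echelon s n e1 d v" and "s \<noteq> 0"
    and "(\<Sum>j<n. Polynomial.smult (c j) (v ! j)) = 0" and "i < n"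
  shows "c i = 0"
proof (rule ccontr)
  assume "c i \<noteq> 0"
  from echelon_leading[of s n e1 d v i c, OF assms(1,2,4) this] show False
    using assms(3) by auto
qed

lemma echelon_ordered_basis:
  assumes v: "echelon s n e1 d v" and s: "s \<noteq> 0"
  shows "ordered_basis (poly_space n e1 d) v"
proof (rule ordered_basis_poly_space)
  show len: "length v = n" and "set v \<subseteq> poly_space n e1 d"
    using v by (auto simp: echelon_def)
  show dist: "distinct v"
    unfolding distinct_conv_nth
  proof (intro allI impI notI)
    fix i j
    assume ij: "i < length v" "j < length v" "i \<noteq> j" and eq: "v ! i = v ! j"
    \<comment> \<open>A repetition is the linear relation \<open>v ! i - v ! j = 0\<close>.\<close>
    let ?c = "\<lambda>k. (if k = i then 1 else 0) - (if k = j then 1 else 0 :: real)"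
    have "(\<Sum>k<n. Polynomial.smult (?c k) (v ! k)) =
        (\<Sum>k<n. (if k = i then v ! k else 0) - (if k = j then v ! k else 0))"
      by (intro sum.cong refl) auto
    also have "\<dots> = 0"
      using ij eq len by (simp add: sum_subtractf)
    finally have "?c i = 0"
      using ij len by (intro echelon_scalars_zero[OF v s]) simp_all
    then show False
      using ij by simp
  qed
  show "poly_vs.independent (set v)"
  proof (rule poly_vs.independent_if_scalars_zero)
    fix f x
    assume zero: "(\<Sum>x\<in>set v. Polynomial.smult (f x) x) = 0" and "x \<in> set v"
    then obtain i where i: "i < n" "x = v ! i"
      using len by (auto simp: in_set_conv_nth)
    have "(\<Sum>j<n. Polynomial.smult (f (v ! j)) (v ! j)) = 0"
      using sum.reindex_bij_betw[OF bij_betw_nth[OF dist refl refl],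
          of "\<lambda>x. Polynomial.smult (f x) x"] zero len
      by simp
    then show "f x = 0"
      using echelon_scalars_zero[OF v s, of "\<lambda>j. f (v ! j)" i] i by simp
  qed simp
qed

text \<open>Change of basis matrices between echelon bases are triangular: if a coordinate after
  position \<open>j\<close> were nonzero, \<open>t ! j\<close> would have a nonzero coefficient at a pivot after its own.\<close>

lemma echelon_coordinate_zero:
  assumes v: "echelon s n e1 d v" and t: "echelon s n e1 d t" and s: "s \<noteq> 0"
    and ij: "i < n" "j < n" "s * int j < s * int i"
  shows "poly_vs.representation (set v) (t ! j) (v ! i) = 0"
proof (rule ccontr)
  let ?c = "\<lambda>i. poly_vs.representation (set v) (t ! j) (v ! i)"
  assume "?c i \<noteq> 0"
  then obtain m where m: "m < n" "s * int i \<le> s * int m"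
    and nz: "coeff (\<Sum>k<n. Polynomial.smult (?c k) (v ! k)) (expo e1 d (m + 1)) \<noteq> 0"
    using echelon_leading[of s n e1 d v i ?c, OF v s ij(1)] by blast
  have "length v = n" and "t ! j \<in> poly_space n e1 d"
    using v t ij(2) by (auto simp: echelon_def)
  then have "(\<Sum>k<n. Polynomial.smult (?c k) (v ! k)) = t ! j"
    using sum_coordinates[OF echelon_ordered_basis[OF v s]] by auto
  then have "coeff (t ! j) (expo e1 d (m + 1)) \<noteq> 0"
    using nz by simp
  then show False
    using t m ij by (simp add: echelon_def)
qed

lemma ordered_basis_nth:
  assumes "ordered_basis V v" and "i < length v"
  shows "v ! i \<in> V" and "v ! i \<noteq> 0"
proof -
  have "v ! i \<in> set v"
    using assms by simp
  then show "v ! i \<in> V" and "v ! i \<noteq> 0"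
    using assms poly_vs.span_base[of "v ! i" "set v"] poly_vs.dependent_zero[of "set v"]
    unfolding ordered_basis_def by metis+
qed

lemma descending_basis_iff_echelon:
  assumes d: "d > 0"
  shows "descending_basis n e1 d v \<longleftrightarrow> echelon 1 n e1 d v"
proof
  assume v: "descending_basis n e1 d v"
  then have B: "ordered_basis (poly_space n e1 d) v" and len: "length v = n"
    and deg: "\<And>i. i < n \<Longrightarrow> degree (v ! i) = expo e1 d (i + 1)"
    by (auto simp: descending_basis_def)
  have "coeff (v ! i) (expo e1 d (i + 1)) \<noteq> 0" if "i < n" for i
    using ordered_basis_nth(2)[OF B, of i] deg[OF that] that len by (metis leading_coeff_neq_0)
  moreover have "coeff (v ! i) (expo e1 d (j + 1)) = 0" if "i < n" "i < j" for i j
    using deg[OF that(1)] that(2) d by (intro coeff_eq_0) (simp add: expo_Suc)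
  moreover have "set v \<subseteq> poly_space n e1 d"
    using B poly_vs.span_superset[of "set v"] by (simp add: ordered_basis_def)
  ultimately show "echelon 1 n e1 d v"
    using len by (simp add: echelon_def)
next
  assume v: "echelon 1 n e1 d v"
  have "degree (v ! i) = expo e1 d (i + 1)" if i: "i < n" for i
  proof (rule antisym)
    show "degree (v ! i) \<le> expo e1 d (i + 1)"
    proof (rule degree_le, intro allI impI, rule ccontr)
      fix e
      assume e: "e > expo e1 d (i + 1)" and nz: "coeff (v ! i) e \<noteq> 0"
      have "v ! i \<in> poly_space n e1 d"
        using v i by (auto simp: echelon_def)
      then obtain j where j: "j < n" "e = expo e1 d (j + 1)"
        using nz by (auto simp: mem_poly_space_iff)
      then have "i < j"
        using e d by (simp add: expo_Suc)
      then show False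
        using v i j nz by (auto simp: echelon_def)
    qed
    show "expo e1 d (i + 1) \<le> degree (v ! i)"
      using v i by (intro le_degree) (simp add: echelon_def)
  qed
  then show "descending_basis n e1 d v"
    using v echelon_ordered_basis[OF v] by (simp add: descending_basis_def echelon_def)
qed

lemma ascending_basis_iff_echelon:
  assumes d: "d > 0"
  shows "ascending_basis n e1 d v \<longleftrightarrow> echelon (- 1) n e1 d v"
proof
  assume v: "ascending_basis n e1 d v"
  then have B: "ordered_basis (poly_space n e1 d) v" and len: "length v = n"
    and deg: "\<And>i. i < n \<Longrightarrow> min_degree (v ! i) = expo e1 d (i + 1)"
    by (auto simp: ascending_basis_def)
  have "coeff (v ! i) (expo e1 d (i + 1)) \<noteq> 0" if "i < n" for i
  proof -
    have "\<exists>e. coeff (v ! i) e \<noteq> 0"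
      using ordered_basis_nth(2)[OF B, of i] that len by (simp add: poly_eq_iff)
    then have "coeff (v ! i) (min_degree (v ! i)) \<noteq> 0"
      unfolding min_degree_def by (rule LeastI_ex)
    then show ?thesis
      using deg[OF that] by simp
  qed
  moreover have "coeff (v ! i) (expo e1 d (j + 1)) = 0" if "i < n" "j < i" for i j
  proof -
    have "expo e1 d (j + 1) < min_degree (v ! i)"
      using deg[OF that(1)] that(2) d by (simp add: expo_Suc)
    then show ?thesis
      unfolding min_degree_def using not_less_Least by blast
  qed
  moreover have "set v \<subseteq> poly_space n e1 d"
    using B poly_vs.span_superset[of "set v"] by (simp add: ordered_basis_def)
  ultimately show "echelon (- 1) n e1 d v"
    using len by (simp add: echelon_def)
next
  assume v: "echelon (- 1) n e1 d v"
  have "min_degree (v ! i) = expo e1 d (i + 1)" if i: "i < n" for i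
    unfolding min_degree_def
  proof (rule Least_equality)
    show "coeff (v ! i) (expo e1 d (i + 1)) \<noteq> 0"
      using v i by (simp add: echelon_def)
    fix e
    assume nz: "coeff (v ! i) e \<noteq> 0"
    have "v ! i \<in> poly_space n e1 d"
      using v i by (auto simp: echelon_def)
    then obtain j where j: "j < n" "e = expo e1 d (j + 1)"
      using nz by (auto simp: mem_poly_space_iff)
    then have "\<not> j < i"
      using v i nz by (auto simp: echelon_def)
    then show "expo e1 d (i + 1) \<le> e"
      using j by (simp add: expo_Suc)
  qed
  then show "ascending_basis n e1 d v"
    using v echelon_ordered_basis[OF v] by (simp add: ascending_basis_def echelon_def)
qed

fun kind_sign :: "kind \<Rightarrow> int" where
  "kind_sign UTr = 1"
| "kind_sign LTr = - 1"
| "kind_sign UAlt = 1"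
| "kind_sign LAlt = - 1"

lemma kind_sign_nonzero: "kind_sign K \<noteq> 0"
  by (cases K) simp_all

lemma basis_of_kind_iff_echelon:
  assumes "d > 0"
  shows "basis_of_kind K n e1 d v \<longleftrightarrow>
    echelon (kind_sign K) n e1 d v \<and> (K \<in> {UAlt, LAlt} \<longrightarrow> alternating n e1 d v)"
  by (cases K) (simp_all add: descending_basis_iff_echelon ascending_basis_iff_echelon assms)

section \<open>Truncation of echelon bases\<close>

lemma coeff_truncate_poly:
  "coeff (truncate_poly n e1 d k1 k2 f) e =
    (if expo e1 d (k1 + 1) \<le> e \<and> e \<le> expo e1 d (n - k2) then coeff f e else 0)"
  by (auto simp: truncate_poly_def coeff_sum)

lemma truncate_poly_linear_combination:
  "truncate_poly n e1 d k1 k2 (\<Sum>i\<in>I. Polynomial.smult (c i) (f i)) =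
    (\<Sum>i\<in>I. Polynomial.smult (c i) (truncate_poly n e1 d k1 k2 (f i)))"
  by (rule poly_eqI) (auto simp: coeff_truncate_poly coeff_sum intro!: sum.neutral)

lemma length_truncate_basis:
  "length v = n \<Longrightarrow> length (truncate_basis n e1 d k1 k2 v) = n - k1 - k2"
  by (simp add: truncate_basis_def)

lemma nth_truncate_basis:
  "length v = n \<Longrightarrow> i < n - k1 - k2 \<Longrightarrow>
    truncate_basis n e1 d k1 k2 v ! i = truncate_poly n e1 d k1 k2 (v ! (k1 + i))"
  by (simp add: truncate_basis_def)

lemma expo_shift: "expo (expo e1 d (k + 1)) d (i + 1) = expo e1 d (k + i + 1)"
  by (simp add: expo_def algebra_simps)

text \<open>Without \<open>k2 < n\<close> the upper bound would be \<open>expo e1 d 0\<close>, which equals \<open>expo e1 d 1\<close>, so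
  the exponent range could still contain a pivot although the window is empty.\<close>

lemma pivot_in_window_iff:
  assumes "d > 0" and "k2 < n"
  shows "expo e1 d (k1 + 1) \<le> expo e1 d (i + 1) \<and> expo e1 d (i + 1) \<le> expo e1 d (n - k2) \<longleftrightarrow>
    k1 \<le> i \<and> i < n - k2"
proof -
  have "n - k2 = Suc (n - k2 - 1)"
    using assms by simp
  then have "expo e1 d (n - k2) = e1 + (n - k2 - 1) * d"
    by (metis expo_Suc)
  then show ?thesis
    using assms by (auto simp: expo_Suc)
qed

lemma echelon_truncate_basis:
  assumes v: "echelon s n e1 d v" and d: "d > 0"
  shows "echelon s (n - k1 - k2) (expo e1 d (k1 + 1)) d (truncate_basis n e1 d k1 k2 v)"
proof -
  let ?m = "n - k1 - k2" and ?\<tau> = "truncate_poly n e1 d k1 k2"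
  let ?w = "truncate_basis n e1 d k1 k2 v"
  have len: "length v = n"
    using v by (simp add: echelon_def)
  have coeff_pivot: "coeff (?w ! i) (expo (expo e1 d (k1 + 1)) d (j + 1)) =
      coeff (v ! (k1 + i)) (expo e1 d (k1 + j + 1))" if "i < ?m" "j < ?m" for i j
    unfolding expo_shift using that pivot_in_window_iff[of d k2 n e1 k1 "k1 + j"] d
    by (simp add: nth_truncate_basis[OF len] coeff_truncate_poly)
  have "?w ! i \<in> poly_space ?m (expo e1 d (k1 + 1)) d" if i: "i < ?m" for i
    unfolding mem_poly_space_iff
  proof (intro allI impI)
    fix e
    assume "coeff (?w ! i) e \<noteq> 0"
    then have nz: "coeff (v ! (k1 + i)) e \<noteq> 0"
      and range: "expo e1 d (k1 + 1) \<le> e" "e \<le> expo e1 d (n - k2)"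
      using i by (auto simp: nth_truncate_basis[OF len] coeff_truncate_poly split: if_splits)
    have "v ! (k1 + i) \<in> set v"
      using len i by (intro nth_mem) simp
    then have "v ! (k1 + i) \<in> poly_space n e1 d"
      using v by (auto simp: echelon_def)
    then obtain j where "j < n" and e: "e = expo e1 d (j + 1)"
      using nz by (auto simp: mem_poly_space_iff)
    moreover have "k1 \<le> j" "j < n - k2"
      using range pivot_in_window_iff[of d k2 n e1 k1 j] d i unfolding e by auto
    ultimately show "\<exists>j<?m. e = expo (expo e1 d (k1 + 1)) d (j + 1)"
      unfolding expo_shift by (intro exI[of _ "j - k1"]) auto
  qed
  then have "set ?w \<subseteq> poly_space ?m (expo e1 d (k1 + 1)) d"
    using length_truncate_basis[OF len, of e1 d k1 k2] by (auto simp: in_set_conv_nth)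
  then show ?thesis
    using v by (simp add: echelon_def length_truncate_basis[OF len] coeff_pivot[simplified]
        distrib_left)
qed

lemma alternating_truncate_basis:
  assumes "alternating n e1 d v" and len: "length v = n"
  shows "alternating (n - k1 - k2) (expo e1 d (k1 + 1)) d (truncate_basis n e1 d k1 k2 v)"
  unfolding alternating_def expo_shift
  using assms(1) by (auto simp: alternating_def nth_truncate_basis[OF len] coeff_truncate_poly
      split: if_splits)

lemma basis_of_kind_truncate_basis:
  assumes "basis_of_kind K n e1 d v" and "d > 0"
  shows "basis_of_kind K (n - k1 - k2) (expo e1 d (k1 + 1)) d (truncate_basis n e1 d k1 k2 v)"
  using assms echelon_truncate_basis[of "kind_sign K" n e1 d v k1 k2]
    alternating_truncate_basis[of n e1 d v k1 k2]
  by (auto simp: basis_of_kind_iff_echelon echelon_def)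

text \<open>All exponents of \<open>v ! i\<close> are pivots, so \<open>\<tau>\<close> kills \<open>v ! i\<close> as soon as its coefficients
  vanish at the pivots of the window. Since the window is an interval of positions, a position
  outside it that precedes one of its members precedes all of them.\<close>

lemma truncate_poly_before_window:
  assumes v: "echelon s n e1 d v" and d: "d > 0" and s: "s \<in> {1, - 1}"
    and i: "i < n" "i \<notin> {k1..<n - k2}"
    and j: "j \<in> {k1..<n - k2}" "s * int i < s * int j"
  shows "truncate_poly n e1 d k1 k2 (v ! i) = 0"
proof (rule poly_eqI)
  fix e
  have "coeff (v ! i) e = 0" if range: "expo e1 d (k1 + 1) \<le> e" "e \<le> expo e1 d (n - k2)"
  proof (rule ccontr)
    assume nz: "coeff (v ! i) e \<noteq> 0"
    have "v ! i \<in> poly_space n e1 d"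
      using v i by (auto simp: echelon_def)
    then obtain l where l: "l < n" and e: "e = expo e1 d (l + 1)"
      using nz by (auto simp: mem_poly_space_iff)
    then have "k1 \<le> l" "l < n - k2"
      using range pivot_in_window_iff[of d k2 n e1 k1 l] d j unfolding e by auto
    then have "s * int i < s * int l"
      using s i j by auto
    then show False
      using v i l nz unfolding e by (auto simp: echelon_def)
  qed
  then show "coeff (truncate_poly n e1 d k1 k2 (v ! i)) e = coeff 0 e"
    by (simp add: coeff_truncate_poly)
qed

lemma truncated_expansion:
  assumes v: "echelon s n e1 d v" and t: "echelon s n e1 d t" and d: "d > 0" and s: "s \<in> {1, - 1}"
    and j: "j \<in> {k1..<n - k2}"
  shows "truncate_poly n e1 d k1 k2 (t ! j) =
    (\<Sum>i\<in>{k1..<n - k2}. Polynomial.smult (poly_vs.representation (set v) (t ! j) (v ! i))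
       (truncate_poly n e1 d k1 k2 (v ! i)))"
proof -
  let ?c = "\<lambda>i. poly_vs.representation (set v) (t ! j) (v ! i)"
  let ?\<tau> = "truncate_poly n e1 d k1 k2"
  have s0: "s \<noteq> 0"
    using s by auto
  have "length v = n" and "t ! j \<in> poly_space n e1 d"
    using v t j by (auto simp: echelon_def)
  then have "?\<tau> (t ! j) = ?\<tau> (\<Sum>i<n. Polynomial.smult (?c i) (v ! i))"
    using sum_coordinates[OF echelon_ordered_basis[OF v s0]] by auto
  also have "\<dots> = (\<Sum>i<n. Polynomial.smult (?c i) (?\<tau> (v ! i)))"
    by (rule truncate_poly_linear_combination)
  also have "\<dots> = (\<Sum>i\<in>{k1..<n - k2}. Polynomial.smult (?c i) (?\<tau> (v ! i)))"
  proof (rule sum.mono_neutral_right)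
    show "\<forall>i\<in>{..<n} - {k1..<n - k2}. Polynomial.smult (?c i) (?\<tau> (v ! i)) = 0"
    proof
      fix i
      assume "i \<in> {..<n} - {k1..<n - k2}"
      then have i: "i < n" "i \<notin> {k1..<n - k2}"
        by auto
      then have "i \<noteq> j"
        using j by auto
      then consider "s * int i < s * int j" | "s * int j < s * int i"
        using s0 by (metis linorder_less_linear mult_cancel_left of_nat_eq_iff)
      then show "Polynomial.smult (?c i) (?\<tau> (v ! i)) = 0"
      proof cases
        case 1
        then show ?thesis
          using truncate_poly_before_window[OF v d s i j] by simp
      next
        case 2
        \<comment> \<open>triangularity of the change of basis matrix\<close>
        then show ?thesis
          using echelon_coordinate_zero[OF v t s0 i(1) _ 2] j by auto
      qed
    qed
  qed auto
  finally show ?thesis .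
qed

lemma pick_atLeastLessThan:
  assumes "i < b - a"
  shows "pick {a..<b} i = a + i"
proof -
  have "{x \<in> {a..<b}. x < a + i} = {a..<a + i}"
    using assms by auto
  then show ?thesis
    using pick_card_in_set[of "a + i" "{a..<b}"] assms by simp
qed

lemma truncate_mat_dim:
  "dim_row (truncate_mat k1 k2 M) = dim_row M - k1 - k2"
  "dim_col (truncate_mat k1 k2 M) = dim_col M - k1 - k2"
proof -
  have "card {i. i < a \<and> i \<in> {k1..<a - k2}} = a - k1 - k2" for a
  proof -
    have "{i. i < a \<and> i \<in> {k1..<a - k2}} = {k1..<a - k2}"
      by auto
    then show ?thesis
      by simp
  qed
  then show "dim_row (truncate_mat k1 k2 M) = dim_row M - k1 - k2"
    "dim_col (truncate_mat k1 k2 M) = dim_col M - k1 - k2"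
    by (simp_all add: truncate_mat_def dim_submatrix)
qed

lemma truncate_mat_index:
  assumes "i < dim_row M - k1 - k2" and "j < dim_col M - k1 - k2"
  shows "truncate_mat k1 k2 M $$ (i, j) = M $$ (k1 + i, k1 + j)"
proof -
  have "truncate_mat k1 k2 M $$ (i, j) =
      M $$ (pick {k1..<dim_row M - k2} i, pick {k1..<dim_col M - k2} j)"
    unfolding truncate_mat_def
    using assms truncate_mat_dim[of k1 k2 M]
    by (intro submatrix_index) (simp_all add: truncate_mat_def dim_submatrix)
  then show ?thesis
    using assms by (simp add: pick_atLeastLessThan)
qed

lemma truncate_mat_basis_matrix:
  assumes v: "echelon s n e1 d v" and t: "echelon s n e1 d t" and d: "d > 0" and s: "s \<in> {1, - 1}"
  shows "truncate_mat k1 k2 (basis_matrix v t) =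
    basis_matrix (truncate_basis n e1 d k1 k2 v) (truncate_basis n e1 d k1 k2 t)"
proof (rule eq_matI)
  let ?T = "truncate_basis n e1 d k1 k2" and ?m = "n - k1 - k2"
  let ?\<tau> = "truncate_poly n e1 d k1 k2"
  have len: "length v = n" "length t = n"
    using v t by (auto simp: echelon_def)
  note lenT = len[THEN length_truncate_basis, of e1 d k1 k2]
  note nthT = len[THEN nth_truncate_basis]
  have s0: "s \<noteq> 0"
    using s by auto
  show "dim_row (truncate_mat k1 k2 (basis_matrix v t)) = dim_row (basis_matrix (?T v) (?T t))"
    "dim_col (truncate_mat k1 k2 (basis_matrix v t)) = dim_col (basis_matrix (?T v) (?T t))"
    by (simp_all add: truncate_mat_dim len lenT)
  fix i j
  assume "i < dim_row (basis_matrix (?T v) (?T t))" and "j < dim_col (basis_matrix (?T v) (?T t))"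
  then have i: "i < ?m" and j: "j < ?m"
    by (simp_all add: lenT)
  let ?c = "\<lambda>l. poly_vs.representation (set v) (t ! (k1 + j)) (v ! (k1 + l))"
  have "?T t ! j = (\<Sum>l\<in>{k1..<n - k2}.
      Polynomial.smult (poly_vs.representation (set v) (t ! (k1 + j)) (v ! l)) (?\<tau> (v ! l)))"
    using truncated_expansion[OF v t d s, of "k1 + j" k1 k2] j by (simp add: nthT)
  also have "\<dots> = (\<Sum>l<?m. Polynomial.smult (?c l) (?\<tau> (v ! (k1 + l))))"
    by (rule sum.reindex_bij_witness[of _ "\<lambda>l. k1 + l" "\<lambda>l. l - k1"]) auto
  also have "\<dots> = (\<Sum>l<length (?T v). Polynomial.smult (?c l) (?T v ! l))"
    by (simp add: lenT nthT)
  finally have "poly_vs.representation (set (?T v)) (?T t ! j) (?T v ! i) = ?c i"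
    using i by (intro coordinates_unique[OF
          echelon_ordered_basis[OF echelon_truncate_basis[OF v d] s0]]) (simp_all add: lenT)
  then show "truncate_mat k1 k2 (basis_matrix v t) $$ (i, j) = basis_matrix (?T v) (?T t) $$ (i, j)"
    using i j by (simp add: truncate_mat_index len lenT basis_matrix_def)
qed

section \<open>The truncation functor\<close>

lemma category_basis_category:
  assumes S: "\<And>v. v \<in> S \<Longrightarrow> ordered_basis V v"
  shows "category (basis_category S)"
proof -
  have mult: "basis_matrix v r * basis_matrix r t = basis_matrix v t"
    if "v \<in> S" "r \<in> S" "t \<in> S" for v r t
    using that S by (intro basis_matrix_mult)
  have one: "1\<^sub>m (length v) = basis_matrix v v" if "v \<in> S" for v
    using basis_matrix_self[OF S[OF that]] by simp
  show ?thesis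
    by unfold_locales (auto simp: basis_category_def mult one)
qed

theorem theorem10:
  fixes K :: kind and n e1 d k1 k2 :: nat
    and A B :: "(real poly list, basis_arrow) cat"
  assumes "d \<in> {1, 2}"
    and "K \<in> {UAlt, LAlt} \<Longrightarrow> d = 1"
    and "A \<in> categories_of_kind K n e1 d"
    and "k1 + k2 \<le> n"
  defines "B \<equiv> basis_category (truncate_basis n e1 d k1 k2 ` Obj A)"
  shows "B \<in> categories_of_kind K (n - k1 - k2) (expo e1 d (k1 + 1)) d \<and>
    (\<exists>Tobj Tarr.
      covariant_functor A B Tobj Tarr \<and>
      Tobj ` Obj A = Obj B \<and> Tarr ` Arr A = Arr B \<and>
      (\<forall>v\<in>Obj A. Tobj v = truncate_basis n e1 d k1 k2 v) \<and>
      (\<forall>v\<in>Obj A. \<forall>t\<in>Obj A. Tarr (v, t, basis_matrix v t) =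
         (Tobj v, Tobj t, truncate_mat k1 k2 (basis_matrix v t))))"
proof -
  let ?T = "truncate_basis n e1 d k1 k2"
  let ?F = "\<lambda>(v, t, M). (?T v, ?T t, truncate_mat k1 k2 M)"
  have d: "d > 0"
    using assms(1) by auto
  obtain S where A: "A = basis_category S" and fin: "finite S"
    and kind: "\<And>v. v \<in> S \<Longrightarrow> basis_of_kind K n e1 d v"
    using assms(3) by (auto simp: categories_of_kind_def)
  have Obj: "Obj A = S"
    by (simp add: A basis_category_def)
  have B: "B = basis_category (?T ` S)"
    by (simp add: B_def Obj)
  have sign: "kind_sign K \<in> {1, - 1}"
    by (cases K) simp_all
  have kindT: "basis_of_kind K (n - k1 - k2) (expo e1 d (k1 + 1)) d w" if "w \<in> ?T ` S" for w
    using that kind basis_of_kind_truncate_basis[OF _ d] by blast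
  have ech: "echelon (kind_sign K) n e1 d v" if "v \<in> S" for v
    using kind[OF that] d by (simp add: basis_of_kind_iff_echelon)
  have basis: "ordered_basis (poly_space n e1 d) v" if "v \<in> S" for v
    using echelon_ordered_basis[OF ech[OF that] kind_sign_nonzero] .
  have basisT: "ordered_basis (poly_space (n - k1 - k2) (expo e1 d (k1 + 1)) d) w"
    if "w \<in> ?T ` S" for w
    using kindT[OF that] d echelon_ordered_basis[OF _ kind_sign_nonzero]
    by (auto simp: basis_of_kind_iff_echelon)
  have trunc: "truncate_mat k1 k2 (basis_matrix v t) = basis_matrix (?T v) (?T t)"
    if "v \<in> S" "t \<in> S" for v t
    using that ech d sign by (intro truncate_mat_basis_matrix)
  have mult: "basis_matrix v r * basis_matrix r t = basis_matrix v t"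
    if "v \<in> S" "r \<in> S" "t \<in> S" for v r t
    using that basis by (intro basis_matrix_mult)
  have multT: "basis_matrix (?T v) (?T r) * basis_matrix (?T r) (?T t) = basis_matrix (?T v) (?T t)"
    if "v \<in> S" "r \<in> S" "t \<in> S" for v r t
    using that basisT by (intro basis_matrix_mult) auto
  have one: "1\<^sub>m (length v) = basis_matrix v v" if "v \<in> S" for v
    using basis_matrix_self[OF basis[OF that]] by simp
  have oneT: "1\<^sub>m (length (?T v)) = basis_matrix (?T v) (?T v)" if "v \<in> S" for v
    using basis_matrix_self[OF basisT] that by simp
  have "covariant_functor A B ?T ?F"
  proof (intro covariant_functor.intro covariant_functor_axioms.intro)
    show "category A" and "category B"
      unfolding A B using basis basisT by (auto intro: category_basis_category)
  qed (auto simp: A B basis_category_def trunc mult multT one oneT)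
  moreover have "?T ` Obj A = Obj B"
    by (simp add: Obj B basis_category_def)
  moreover have "?F ` Arr A = Arr B"
  proof
    show "?F ` Arr A \<subseteq> Arr B"
      by (auto simp: A B basis_category_def trunc)
    show "Arr B \<subseteq> ?F ` Arr A"
    proof
      fix f
      assume "f \<in> Arr B"
      then obtain v t where vt: "v \<in> S" "t \<in> S" and f: "f = (?T v, ?T t, basis_matrix (?T v) (?T t))"
        by (auto simp: B basis_category_def)
      then have "f = ?F (v, t, basis_matrix v t)"
        by (simp add: trunc)
      moreover have "(v, t, basis_matrix v t) \<in> Arr A"
        using vt by (auto simp: A basis_category_def)
      ultimately show "f \<in> ?F ` Arr A"
        by blast
    qed
  qed
  moreover have "B \<in> categories_of_kind K (n - k1 - k2) (expo e1 d (k1 + 1)) d"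
    unfolding categories_of_kind_def B using fin kindT by blast
  ultimately show ?thesis
    by (intro conjI exI[of _ ?T] exI[of _ ?F]) auto
qed

end
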